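(* In a comparability digraph $D=(V,A)$, every stable set is sink-stable.
   Context: Digraphs are finite. A comparability digraph is an acyclic and transitive digraph (transitive: if $uv$ and $vz$ are edges then $uz$ is an edge). A set of nodes is stable if no two of its nodes are joined by an edge. A directed cut (dicut) of a digraph is the set of edges entering a subset $Z$ of nodes, provided no edge leaves $Z$. A sink node is a node with no leaving edge; a sink set is a set of nodes each of which is a sink. A set of nodes is sink-stable in $D$ if there are pairwise edge-disjoint dicuts of $D$ such that, after reversing the orientation of all edges of these dicuts, the set becomes a sink set. *)

theory Defs
  imports "Graph_Theory.Arc_Walk"
begin

text \<open>Digraphs may have parallel arcs; sets of edges are sets of arc identifiers.\<close>

locale comparability_digraph = fin_digraph +
  assumes acyclic: "\<not> (\<exists>p. cycle p)"
    and transitive: "trans (arcs_ends G)"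

definition stable_set :: "('a, 'b) pre_digraph \<Rightarrow> 'a set \<Rightarrow> bool" where
  "stable_set G S \<longleftrightarrow>
     S \<subseteq> verts G \<and> (\<forall>u\<in>S. \<forall>v\<in>S. u \<noteq> v \<longrightarrow> \<not> u \<rightarrow>\<^bsub>G\<^esub> v)"

definition entering_arcs :: "('a, 'b) pre_digraph \<Rightarrow> 'a set \<Rightarrow> 'b set" where
  "entering_arcs G Z = {e \<in> arcs G. tail G e \<notin> Z \<and> head G e \<in> Z}"

definition leaving_arcs :: "('a, 'b) pre_digraph \<Rightarrow> 'a set \<Rightarrow> 'b set" where
  "leaving_arcs G Z = {e \<in> arcs G. tail G e \<in> Z \<and> head G e \<notin> Z}"

definition dicut :: "('a, 'b) pre_digraph \<Rightarrow> 'b set \<Rightarrow> bool" where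
  "dicut G C \<longleftrightarrow>
     (\<exists>Z. Z \<subseteq> verts G \<and> leaving_arcs G Z = {} \<and> C = entering_arcs G Z)"

definition reverse_arcs :: "('a, 'b) pre_digraph \<Rightarrow> 'b set \<Rightarrow> ('a, 'b) pre_digraph" where
  "reverse_arcs G F =
     G\<lparr>tail := \<lambda>e. if e \<in> F then head G e else tail G e,
       head := \<lambda>e. if e \<in> F then tail G e else head G e\<rparr>"

definition sink_node :: "('a, 'b) pre_digraph \<Rightarrow> 'a \<Rightarrow> bool" where
  "sink_node G v \<longleftrightarrow> v \<in> verts G \<and> out_arcs G v = {}"

definition sink_set :: "('a, 'b) pre_digraph \<Rightarrow> 'a set \<Rightarrow> bool" where
  "sink_set G S \<longleftrightarrow> (\<forall>v\<in>S. sink_node G v)"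

text \<open>A family of pairwise disjoint dicuts can be taken as a set of dicuts, since
  only the empty dicut can occur repeatedly in such a family.\<close>

definition sink_stable :: "('a, 'b) pre_digraph \<Rightarrow> 'a set \<Rightarrow> bool" where
  "sink_stable G S \<longleftrightarrow>
     (\<exists>\<C>. (\<forall>C\<in>\<C>. dicut G C) \<and> pairwise disjnt \<C> \<and>
          sink_set (reverse_arcs G (\<Union>\<C>)) S)"

end

theory Submission
  imports Defs
begin

text \<open>A single dicut suffices. Let \<open>Z\<close> be the set of nodes that have an in-neighbour in the
  stable set \<open>S\<close>. By transitivity, no arc leaves \<open>Z\<close>, so the arcs entering \<open>Z\<close>
  form a dicut. Stability, together with the absence of loops, makes \<open>Z\<close> disjoint from \<open>S\<close>.
  Hence every arc leaving \<open>S\<close> enters \<open>Z\<close> and gets reversed, whereas no arc with its head in \<open>S\<close>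
  enters \<open>Z\<close>, so the reversal creates no new arc leaving \<open>S\<close>.\<close>

lemma (in wf_digraph) loop_is_cycle:
  assumes "e \<in> arcs G" "tail G e = head G e"
  shows "cycle [e]"
  unfolding cycle_def using assms
  by (intro exI[of _ "tail G e"]) (auto simp: awalk_def)

lemma (in comparability_digraph) not_dominates_self: "\<not> u \<rightarrow> u"
  using acyclic loop_is_cycle by (auto simp: arcs_ends_def arc_to_ends_def)

definition out_neighbourhood :: "('a, 'b) pre_digraph \<Rightarrow> 'a set \<Rightarrow> 'a set" where
  "out_neighbourhood G S = {v. \<exists>s\<in>S. s \<rightarrow>\<^bsub>G\<^esub> v}"

text \<open>Out-neighbourhoods in a transitive digraph are closed under following arcs.\<close>

lemma (in wf_digraph) dicut_entering_out_neighbourhood: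
  assumes "trans (arcs_ends G)"
  shows "dicut G (entering_arcs G (out_neighbourhood G S))"
  unfolding dicut_def
proof (intro exI[of _ "out_neighbourhood G S"] conjI refl)
  show "out_neighbourhood G S \<subseteq> verts G"
    by (auto simp: out_neighbourhood_def)
  show "leaving_arcs G (out_neighbourhood G S) = {}"
    using assms by (auto simp: leaving_arcs_def out_neighbourhood_def
        dest: transD in_arcs_imp_in_arcs_ends)
qed

text \<open>Within \<open>S\<close>, stability only excludes arcs between distinct nodes; loops are excluded by
  acyclicity.\<close>

lemma (in comparability_digraph) stable_set_disjoint_out_neighbourhood:
  assumes "stable_set G S"
  shows "S \<inter> out_neighbourhood G S = {}"
  using assms not_dominates_self by (fastforce simp: stable_set_def out_neighbourhood_def)

theorem proposition1p1:
  fixes D :: "('a, 'b) pre_digraph" and S :: "'a set"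
  assumes "comparability_digraph D" and "stable_set D S"
  shows "sink_stable D S"
proof -
  interpret comparability_digraph D by fact
  define Z where "Z = out_neighbourhood D S"
  define C where "C = entering_arcs D Z"
  have disj: "S \<inter> Z = {}"
    unfolding Z_def using assms(2) by (rule stable_set_disjoint_out_neighbourhood)
  have "out_arcs (reverse_arcs D C) s = {}" if "s \<in> S" for s
  proof -
    have False if e: "e \<in> arcs D" and s: "(if e \<in> C then head D e else tail D e) = s" for e
    proof (cases "e \<in> C")
      case True
      then have "s \<in> Z"
        using s by (auto simp: C_def entering_arcs_def)
      then show False
        using disj \<open>s \<in> S\<close> by blast
    next
      case False
      then have "tail D e = s"
        using s by simp
      then have "head D e \<in> Z" "tail D e \<notin> Z"
        using e disj \<open>s \<in> S\<close> in_arcs_imp_in_arcs_ends[OF e]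
        by (auto simp: Z_def out_neighbourhood_def)
      then show False
        using False e by (simp add: C_def entering_arcs_def)
    qed
    then show ?thesis
      by (auto simp: out_arcs_def reverse_arcs_def split del: if_split)
  qed
  moreover have "S \<subseteq> verts D"
    using assms(2) by (simp add: stable_set_def)
  ultimately have "sink_set (reverse_arcs D (\<Union>{C})) S"
    by (auto simp: sink_set_def sink_node_def reverse_arcs_def)
  moreover have "dicut D C"
    unfolding C_def Z_def using transitive by (rule dicut_entering_out_neighbourhood)
  ultimately show ?thesis
    unfolding sink_stable_def by (intro exI[of _ "{C}"]) simp
qed

end
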